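(* There exist constants $0 < c < C$ such that for any $n \in \mathbb{N}$ (with $n \ge 1$), one can find an $n \times n$ matrix $V$ with all entries in $\{-1, 1\}$ satisfying $$c\sqrt{n} \le s_{\min}(V) \le s_{\max}(V) \le C\sqrt{n}.$$
   Context: For a real $n\times n$ matrix $V$, $s_{\max}(V)$ and $s_{\min}(V)$ denote its largest and smallest singular values, i.e. the square roots of the largest and smallest eigenvalues of $VV^\top$. The constants $c, C$ do not depend on $n$. *)

theory Defs
  imports "Jordan_Normal_Form.Spectral_Radius"
begin

text \<open>
  For square \<open>V\<close> of dimension at least 1, the matrix \<open>V * V\<^sup>T\<close> is real, symmetric and positive
  semidefinite, so its real spectrum is a nonempty finite set of nonnegative reals; only then are
  \<open>Max\<close> and \<open>Min\<close> below meaningful.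
\<close>

definition s_max :: "real mat \<Rightarrow> real" where
  "s_max V = sqrt (Max (spectrum (V * transpose_mat V)))"

definition s_min :: "real mat \<Rightarrow> real" where
  "s_min V = sqrt (Min (spectrum (V * transpose_mat V)))"

end

theory Submission
  imports Defs "HOL-Analysis.L2_Norm"
begin

text \<open>
  Write \<open>n = N + m\<close> with \<open>N\<close> a power of two and \<open>m < N\<close>. Let \<open>A, B, C\<close> be
  Hadamard matrices of order \<open>N\<close>, \<open>A\<close> symmetric, such that \<open>C A B / N = E\<close> has symmetric part
  \<open>\<sigma> I\<close> with \<open>\<sigma>\<close> of order \<open>\<surd>N\<close>, and let \<open>K\<close> be a Hadamard matrix with symmetric
  part \<open>I\<close>. The Schur complement of \<open>A\<close> in \<open>[[A, B], [C, -K]]\<close> is \<open>-(K + E)\<close>, whose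
  symmetric part is at most \<open>-\<sigma> I\<close>. This property passes to leading principal blocks, unlike a
  bound on singular values, so cutting the block matrix down to its first \<open>n\<close> rows and columns
  keeps all singular values of order \<open>\<surd>N\<close>.
\<close>

section \<open>Matrices as functions, Kronecker products and Hadamard matrices\<close>

definition mat_mul :: "nat \<Rightarrow> (nat \<Rightarrow> nat \<Rightarrow> real) \<Rightarrow> (nat \<Rightarrow> nat \<Rightarrow> real) \<Rightarrow> nat \<Rightarrow> nat \<Rightarrow> real" where
  "mat_mul N P Q i j = (\<Sum>l<N. P i l * Q l j)"

definition mat_app :: "nat \<Rightarrow> (nat \<Rightarrow> nat \<Rightarrow> real) \<Rightarrow> (nat \<Rightarrow> real) \<Rightarrow> nat \<Rightarrow> real" where
  "mat_app N P x i = (\<Sum>l<N. P i l * x l)"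

definition kron :: "nat \<Rightarrow> (nat \<Rightarrow> nat \<Rightarrow> real) \<Rightarrow> (nat \<Rightarrow> nat \<Rightarrow> real) \<Rightarrow> nat \<Rightarrow> nat \<Rightarrow> real" where
  "kron q P p i j = P (i div q) (j div q) * p (i mod q) (j mod q)"

text \<open>Orthogonality is that of the columns, \<open>A\<^sup>T A = N I\<close>, the form in
  which \<open>A\<close> multiplies Euclidean norms by \<open>sqrt N\<close>.\<close>

definition hadamard :: "nat \<Rightarrow> (nat \<Rightarrow> nat \<Rightarrow> real) \<Rightarrow> bool" where
  "hadamard N A \<longleftrightarrow> (\<forall>i<N. \<forall>j<N. A i j \<in> {-1, 1}) \<and>
     (\<forall>i<N. \<forall>j<N. (\<Sum>l<N. A l i * A l j) = (if i = j then real N else 0))"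

lemma hadamard_sign: "hadamard N A \<Longrightarrow> i < N \<Longrightarrow> j < N \<Longrightarrow> A i j \<in> {-1, 1}"
  by (simp add: hadamard_def)

lemma sum_div_mod:
  fixes f :: "nat \<Rightarrow> nat \<Rightarrow> real"
  assumes "0 < q"
  shows "(\<Sum>l<q * N. f (l div q) (l mod q)) = (\<Sum>a<N. \<Sum>b<q. f a b)"
proof -
  have lt: "a * q + b < q * N" if "a < N" "b < q" for a b
  proof -
    have "a * q + b < Suc a * q" using that by simp
    also have "\<dots> \<le> N * q" using that by (intro mult_right_mono) auto
    finally show ?thesis by (simp add: mult.commute)
  qed
  have "(\<Sum>l<q * N. f (l div q) (l mod q)) = (\<Sum>(a,b)\<in>{..<N} \<times> {..<q}. f a b)"
    by (rule sum.reindex_bij_witness[of _ "\<lambda>(a,b). a * q + b" "\<lambda>l. (l div q, l mod q)"])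
      (use assms lt in \<open>auto simp: less_mult_imp_div_less mult.commute\<close>)
  then show ?thesis by (simp add: sum.cartesian_product)
qed

text \<open>The mixed-product rule: splitting the summation index into quotient and remainder modulo
  \<open>q\<close> factors the sum.\<close>

lemma mat_mul_kron:
  assumes "0 < q"
  shows "mat_mul (q * N) (kron q P p) (kron q Q r) = kron q (mat_mul N P Q) (mat_mul q p r)"
proof (intro ext)
  fix i j
  have "mat_mul (q * N) (kron q P p) (kron q Q r) i j = (\<Sum>l<q * N. (\<lambda>a b. (P (i div q) a * Q a (j div q)) *
      (p (i mod q) b * r b (j mod q))) (l div q) (l mod q))"
    by (simp add: mat_mul_def kron_def algebra_simps)
  also have "\<dots> = (\<Sum>a<N. \<Sum>b<q. (P (i div q) a * Q a (j div q)) * (p (i mod q) b * r b (j mod q)))"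
    by (rule sum_div_mod[OF assms])
  also have "\<dots> = kron q (mat_mul N P Q) (mat_mul q p r) i j"
    by (simp add: mat_mul_def kron_def sum_product)
  finally show "mat_mul (q * N) (kron q P p) (kron q Q r) i j = kron q (mat_mul N P Q) (mat_mul q p r) i j" .
qed

lemma div_mod_eq_iff: "i div q = j div q \<and> i mod q = j mod q \<longleftrightarrow> i = (j::nat)"
  by (metis div_mod_decomp)

text \<open>By the mixed-product rule applied to the transpose, the Gram matrix of a Kronecker
  product is the Kronecker product of the Gram matrices \<open>N I\<close> and
  \<open>q I\<close>.\<close>

lemma hadamard_kron:
  assumes P: "hadamard N P" and p: "hadamard q p" and q: "0 < q"
  shows "hadamard (q * N) (kron q P p)"
  unfolding hadamard_def
proof (intro conjI allI impI)
  fix i j assume ij: "i < q * N" "j < q * N"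
  then have d: "i div q < N" "j div q < N" "i mod q < q" "j mod q < q"
    using q by (auto simp: less_mult_imp_div_less mult.commute)
  show "kron q P p i j \<in> {-1, 1}"
    using hadamard_sign[OF P d(1,2)] hadamard_sign[OF p d(3,4)] by (auto simp: kron_def)
  have "(\<Sum>l<q * N. kron q P p l i * kron q P p l j) =
      mat_mul (q * N) (kron q (\<lambda>i j. P j i) (\<lambda>i j. p j i)) (kron q P p) i j"
    by (simp add: mat_mul_def kron_def)
  also have "\<dots> = mat_mul N (\<lambda>i j. P j i) P (i div q) (j div q) * mat_mul q (\<lambda>i j. p j i) p (i mod q) (j mod q)"
    by (simp add: mat_mul_kron[OF q]) (simp add: kron_def)
  also have "\<dots> = (if i = j then real (q * N) else 0)"
    using P p d div_mod_eq_iff[of i q j] by (auto simp: mat_mul_def hadamard_def)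
  finally show "(\<Sum>l<q * N. kron q P p l i * kron q P p l j) = (if i = j then real (q * N) else 0)" .
qed

section \<open>Triples of Hadamard matrices whose product has scalar symmetric part\<close>

text \<open>
  \<open>A4 = J - 2I\<close>, \<open>C4\<close> is the Sylvester matrix of order 4, and \<open>B4 = A4 C4 / 2\<close>. That \<open>B4\<close> has
  entries \<open>\<plusminus>1\<close> says that the two orthogonal bases are mutually unbiased; it makes \<open>C4 A4 B4 = 8I\<close>.
\<close>

definition A4 :: "nat \<Rightarrow> nat \<Rightarrow> real" where
  "A4 i j = (if i = j then -1 else 1)"

definition C4 :: "nat \<Rightarrow> nat \<Rightarrow> real" where
  "C4 i j = (if i div 2 = 1 \<and> j div 2 = 1 then -1 else 1) * (if i mod 2 = 1 \<and> j mod 2 = 1 then -1 else 1)"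

definition B4 :: "nat \<Rightarrow> nat \<Rightarrow> real" where
  "B4 i j = (if j = 0 then 1 else -1) * C4 i j"

lemma all_less4: "(\<forall>i<4. P i) \<longleftrightarrow> P 0 \<and> P 1 \<and> P 2 \<and> P (3::nat)"
proof -
  have "i < 4 \<longleftrightarrow> i = 0 \<or> i = 1 \<or> i = 2 \<or> i = 3" for i :: nat by auto
  then show ?thesis by auto
qed

lemma sum4: "(\<Sum>l<4::nat. f l) = f 0 + f 1 + f 2 + (f 3 :: real)"
  by (simp add: eval_nat_numeral)

lemma hadamard4: "hadamard 4 A4" "hadamard 4 B4" "hadamard 4 C4"
  unfolding hadamard_def all_less4 sum4 by (simp_all add: A4_def B4_def C4_def)

lemma mat_mul4:
  assumes "i < 4" "j < 4"
  shows "mat_mul 4 (mat_mul 4 C4 A4) B4 i j = (if i = j then 8 else 0)"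
proof -
  have "\<forall>i<4. \<forall>j<4. mat_mul 4 (mat_mul 4 C4 A4) B4 i j = (if i = j then 8 else 0)"
    unfolding mat_mul_def all_less4 sum4 by (simp add: A4_def B4_def C4_def)
  then show ?thesis using assms by blast
qed

text \<open>Symmetry of \<open>A\<close> makes \<open>A / N\<close> its inverse, so
  \<open>C A B / N\<close> is the term that eliminating the block \<open>A\<close> produces. For
  positive \<open>N\<close> it is \<open>sqrt N\<close> times an orthogonal matrix, so
  \<open>\<sigma>\<close> cannot exceed \<open>sqrt N\<close>.\<close>

definition unbiased_triple ::
  "nat \<Rightarrow> real \<Rightarrow> (nat \<Rightarrow> nat \<Rightarrow> real) \<Rightarrow> (nat \<Rightarrow> nat \<Rightarrow> real) \<Rightarrow> (nat \<Rightarrow> nat \<Rightarrow> real) \<Rightarrow> bool" where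
  "unbiased_triple N \<sigma> A B C \<longleftrightarrow> hadamard N A \<and> hadamard N B \<and> hadamard N C \<and>
     (\<forall>i<N. \<forall>j<N. A j i = A i j) \<and>
     (\<forall>i<N. \<forall>j<N. mat_mul N (mat_mul N C A) B i j + mat_mul N (mat_mul N C A) B j i = (if i = j then 2 * real N * \<sigma> else 0))"

text \<open>Since \<open>C4 A4 B4 = 8 I\<close>, the new product is the old one tensored with
  \<open>8 I\<close>, and likewise for its symmetric part. As 8 = 4 * 2, the order grows by 4 and
  \<open>\<sigma>\<close> by 2, so the ratio of \<open>\<sigma>\<^sup>2\<close> to the order is
  preserved.\<close>

lemma unbiased_triple_step:
  assumes "unbiased_triple N \<sigma> A B C"
  shows "unbiased_triple (4 * N) (2 * \<sigma>) (kron 4 A A4) (kron 4 B B4) (kron 4 C C4)"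
  unfolding unbiased_triple_def
proof (intro conjI allI impI)
  note a = assms[unfolded unbiased_triple_def]
  show "hadamard (4 * N) (kron 4 A A4)" "hadamard (4 * N) (kron 4 B B4)" "hadamard (4 * N) (kron 4 C C4)"
    using a hadamard4 by (auto intro!: hadamard_kron)
  fix i j assume ij: "i < 4 * N" "j < 4 * N"
  then have d: "i div 4 < N" "j div 4 < N" "i mod 4 < 4" "j mod 4 < 4"
    by auto
  show "kron 4 A A4 j i = kron 4 A A4 i j"
    using a d by (auto simp: kron_def A4_def)
  let ?E = "mat_mul N (mat_mul N C A) B"
  have "mat_mul (4 * N) (mat_mul (4 * N) (kron 4 C C4) (kron 4 A A4)) (kron 4 B B4) i j +
      mat_mul (4 * N) (mat_mul (4 * N) (kron 4 C C4) (kron 4 A A4)) (kron 4 B B4) j i =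
      (if i mod 4 = j mod 4 then 8 else 0) * (?E (i div 4) (j div 4) + ?E (j div 4) (i div 4))"
    using d by (auto simp: mat_mul_kron) (auto simp: kron_def mat_mul4)
  also have "\<dots> = (if i = j then 2 * real (4 * N) * (2 * \<sigma>) else 0)"
    using a d div_mod_eq_iff[of i 4 j] by auto
  finally show "mat_mul (4 * N) (mat_mul (4 * N) (kron 4 C C4) (kron 4 A A4)) (kron 4 B B4) i j +
      mat_mul (4 * N) (mat_mul (4 * N) (kron 4 C C4) (kron 4 A A4)) (kron 4 B B4) j i =
      (if i = j then 2 * real (4 * N) * (2 * \<sigma>) else 0)" .
qed

lemma less2: "(i::nat) < 2 \<longleftrightarrow> i = 0 \<or> i = 1"
  by auto

lemma unbiased_triple_1: "unbiased_triple 1 1 (\<lambda>_ _. 1) (\<lambda>_ _. 1) (\<lambda>_ _. 1)"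
  by (auto simp: unbiased_triple_def hadamard_def mat_mul_def)

text \<open>
  In order 2 no product of three Hadamard matrices is scalar (\<open>2\<surd>2\<close> is irrational), but \<open>\<surd>2\<close> times
  a rotation by 45 degrees still has scalar symmetric part.
\<close>

lemma unbiased_triple_2:
  defines "h \<equiv> \<lambda>i j. if i = 1 \<and> j = 1 then -1 else 1 :: real"
  shows "unbiased_triple 2 1 h h (\<lambda>i j. if i = 1 \<and> j = 0 then -1 else 1)"
proof -
  have s: "(\<Sum>l<2::nat. f l) = f 0 + (f 1 :: real)" for f by (simp add: eval_nat_numeral)
  show ?thesis
    unfolding unbiased_triple_def hadamard_def mat_mul_def less2 s h_def by auto
qed

text \<open>Each step raises \<open>k\<close> by 2, hence the two starting orders 1 and 2. The ratio
  of \<open>\<sigma>\<^sup>2\<close> to the order is 1 for even \<open>k\<close> and 1/2 for odd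
  \<open>k\<close>, which explains the factor 2.\<close>

lemma unbiased_triple_exists:
  "\<exists>\<sigma> A B C. 0 \<le> \<sigma> \<and> 2 ^ k \<le> 2 * \<sigma>\<^sup>2 \<and> unbiased_triple (2 ^ k) \<sigma> A B C"
proof (induction k rule: induct_nat_012)
  case 0
  then show ?case using unbiased_triple_1 by (intro exI[of _ 1]) (auto intro!: exI)
next
  case 1
  then show ?case using unbiased_triple_2 by (intro exI[of _ 1]) (auto intro!: exI)
next
  case (ge2 k)
  then obtain \<sigma> A B C where h: "0 \<le> \<sigma>" "2 ^ k \<le> 2 * \<sigma>\<^sup>2" "unbiased_triple (2 ^ k) \<sigma> A B C"
    by auto
  have "unbiased_triple (2 ^ Suc (Suc k)) (2 * \<sigma>) (kron 4 A A4) (kron 4 B B4) (kron 4 C C4)"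
    using unbiased_triple_step[OF h(3)] by simp
  moreover have "0 \<le> 2 * \<sigma>" "2 ^ Suc (Suc k) \<le> 2 * (2 * \<sigma>)\<^sup>2"
    using h by (auto simp: power_mult_distrib)
  ultimately show ?case by blast
qed

section \<open>Skew Hadamard matrices by doubling\<close>

definition skew_hadamard :: "nat \<Rightarrow> (nat \<Rightarrow> nat \<Rightarrow> real) \<Rightarrow> bool" where
  "skew_hadamard N K \<longleftrightarrow> hadamard N K \<and> hadamard N (\<lambda>i j. K j i) \<and>
     (\<forall>i<N. \<forall>j<N. K i j + K j i = (if i = j then 2 else 0))"

text \<open>The doubling \<open>[[K, K], [-K\<^sup>T, K\<^sup>T]]\<close>, with the parity of an index selecting its block.\<close>

definition skew_double :: "(nat \<Rightarrow> nat \<Rightarrow> real) \<Rightarrow> nat \<Rightarrow> nat \<Rightarrow> real" where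
  "skew_double K i j = (if even i then K (i div 2) (j div 2)
     else (if even j then -1 else 1) * K (j div 2) (i div 2))"

text \<open>In the symmetric part the off-diagonal blocks \<open>K\<close> and
  \<open>-K\<^sup>T\<close> cancel, while \<open>K\<close> and \<open>K\<^sup>T\<close> on the
  diagonal each contribute \<open>I\<close>. Columns from different halves are orthogonal because
  \<open>K\<^sup>T K - K K\<^sup>T = 0\<close>, which is why orthogonality of rows and of columns is
  carried along together.\<close>

lemma skew_hadamard_double:
  assumes "skew_hadamard N K"
  shows "skew_hadamard (2 * N) (skew_double K)"
proof -
  note K = assms[unfolded skew_hadamard_def]
  let ?d = "\<lambda>i j. if i = j then real N else 0"
  have sgn: "K i j \<in> {-1, 1}" if "i < N" "j < N" for i j
    using K that by (auto simp: hadamard_def)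
  have cols: "(\<Sum>l<N. K l i * K l j) = ?d i j" and rows: "(\<Sum>l<N. K i l * K j l) = ?d i j"
    if "i < N" "j < N" for i j
    using K that by (auto simp: hadamard_def)
  have sk: "K j i = (if i = j then 2 else 0) - K i j" if "i < N" "j < N" for i j
    using K that by (auto simp: algebra_simps)
  have split: "(\<Sum>l<2 * N. f l) = (\<Sum>a<N. f (2 * a) + f (2 * a + 1))" for f :: "nat \<Rightarrow> real"
    by (induction N) auto
  have eq: "i = j \<longleftrightarrow> i div 2 = j div 2 \<and> (even i \<longleftrightarrow> even j)" for i j :: nat
    by presburger
  show ?thesis
    unfolding skew_hadamard_def hadamard_def
  proof (intro conjI allI impI)
    fix i j assume ij: "i < 2 * N" "j < 2 * N"
    then have d: "i div 2 < N" "j div 2 < N" by auto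
    define a b where "a = i div 2" and "b = j div 2"
    have ab: "a < N" "b < N" using d by (auto simp: a_def b_def)
    show "skew_double K i j \<in> {-1, 1}" "skew_double K j i \<in> {-1, 1}"
      using sgn d by (auto simp: skew_double_def)
    show "skew_double K i j + skew_double K j i = (if i = j then 2 else 0)"
      unfolding skew_double_def eq[of i j] a_def[symmetric] b_def[symmetric]
      using sk[OF ab] sk[OF ab(1) ab(1)] by auto
    show "(\<Sum>l<2 * N. skew_double K i l * skew_double K j l) = (if i = j then real (2 * N) else 0)"
      unfolding skew_double_def eq[of i j] a_def[symmetric] b_def[symmetric] split
      using cols[OF ab] rows[OF ab] by
        (cases "even i"; cases "even j"; simp add: sum.distrib sum_negf flip: sum_distrib_left)
    show "(\<Sum>l<2 * N. skew_double K l i * skew_double K l j) = (if i = j then real (2 * N) else 0)"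
      unfolding skew_double_def eq[of i j] a_def[symmetric] b_def[symmetric] split
      using cols[OF ab] rows[OF ab] by (cases "even i"; cases "even j"; simp add: sum.distrib sum_negf sum_subtractf)
  qed
qed

lemma skew_hadamard_exists: "\<exists>K. skew_hadamard (2 ^ k) K"
proof (induction k)
  case 0
  have "skew_hadamard 1 (\<lambda>_ _. 1)" by (simp add: skew_hadamard_def hadamard_def)
  then show ?case by auto
next
  case (Suc k)
  then show ?case using skew_hadamard_double by fastforce
qed

section \<open>Action on vectors, Euclidean norms and quadratic forms\<close>

lemma mat_app_add: "mat_app N P (\<lambda>l. x l + y l) i = mat_app N P x i + mat_app N P y i"
  by (simp add: mat_app_def algebra_simps sum.distrib)

lemma mat_app_mat_mul: "mat_app N P (mat_app N Q x) = mat_app N (mat_mul N P Q) x"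
proof
  fix i
  have "mat_app N P (mat_app N Q x) i = (\<Sum>l<N. \<Sum>j<N. P i l * Q l j * x j)"
    by (simp add: mat_app_def sum_distrib_left mult.assoc)
  also have "\<dots> = (\<Sum>j<N. \<Sum>l<N. P i l * Q l j * x j)" by (rule sum.swap)
  finally show "mat_app N P (mat_app N Q x) i = mat_app N (mat_mul N P Q) x i"
    by (simp add: mat_app_def mat_mul_def sum_distrib_right)
qed

lemma mat_app_cong: "(\<And>l. l < N \<Longrightarrow> x l = y l) \<Longrightarrow> mat_app N P x = mat_app N P y"
  by (auto simp: mat_app_def fun_eq_iff intro: sum.cong)

lemma transpose_hadamard_app:
  assumes "hadamard N A" "i < N"
  shows "mat_app N (\<lambda>i j. A j i) (mat_app N A x) i = real N * x i"
proof -
  have "mat_app N (\<lambda>i j. A j i) (mat_app N A x) i = (\<Sum>j<N. (if i = j then real N else 0) * x j)"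
    unfolding mat_app_mat_mul mat_app_def mat_mul_def using assms by (intro sum.cong) (auto simp: hadamard_def)
  also have "\<dots> = real N * x i"
    using assms(2) by (simp add: if_distrib[of "\<lambda>t. t * _"] cong: if_cong)
  finally show ?thesis .
qed

lemma mat_app_adjoint: "(\<Sum>i<N. y i * mat_app N A x i) = (\<Sum>j<N. mat_app N (\<lambda>i j. A j i) y j * x j)"
proof -
  have "(\<Sum>i<N. y i * mat_app N A x i) = (\<Sum>i<N. \<Sum>j<N. A i j * y i * x j)"
    by (simp add: mat_app_def sum_distrib_left algebra_simps)
  also have "\<dots> = (\<Sum>j<N. \<Sum>i<N. A i j * y i * x j)" by (rule sum.swap)
  finally show ?thesis by (simp add: mat_app_def sum_distrib_right)
qed

text \<open>The squared norm of \<open>A x\<close> is the pairing of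
  \<open>A\<^sup>T A x = N x\<close> with \<open>x\<close>.\<close>

lemma hadamard_L2:
  assumes "hadamard N A"
  shows "L2_set (mat_app N A x) {..<N} = sqrt N * L2_set x {..<N}"
proof -
  have "(\<Sum>i<N. (mat_app N A x i)\<^sup>2) = (\<Sum>j<N. mat_app N (\<lambda>i j. A j i) (mat_app N A x) j * x j)"
    unfolding mat_app_adjoint[where y = "mat_app N A x", symmetric] by (simp add: power2_eq_square mult.commute)
  also have "\<dots> = real N * (\<Sum>j<N. (x j)\<^sup>2)"
    by (simp add: transpose_hadamard_app[OF assms] sum_distrib_left power2_eq_square mult.assoc)
  finally show ?thesis by (simp add: L2_set_def real_sqrt_mult)
qed

text \<open>A quadratic form sees only the symmetric part of its matrix, obtained by averaging the
  form with its transpose.\<close>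

lemma quadratic_form_sym:
  assumes "\<And>i j. i < N \<Longrightarrow> j < N \<Longrightarrow> P i j + P j i = (if i = j then 2 * s else 0)"
  shows "(\<Sum>i<N. z i * mat_app N P z i) = s * (\<Sum>i<N. (z i)\<^sup>2)"
proof -
  have "2 * (\<Sum>i<N. z i * mat_app N P z i) = (\<Sum>i<N. z i * mat_app N P z i) + (\<Sum>i<N. mat_app N (\<lambda>i j. P j i) z i * z i)"
    using mat_app_adjoint[where y = z and x = z and A = P and N = N] by simp
  also have "\<dots> = (\<Sum>i<N. \<Sum>j<N. z i * ((P i j + P j i) * z j))"
    by (simp add: mat_app_def sum_distrib_left distrib_left distrib_right sum.distrib mult.commute mult.left_commute)
  also have "\<dots> = (\<Sum>i<N. \<Sum>j<N. if i = j then 2 * s * (z i)\<^sup>2 else 0)"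
    by (intro sum.cong refl) (auto simp: assms power2_eq_square)
  also have "\<dots> = 2 * (s * (\<Sum>i<N. (z i)\<^sup>2))"
    by (simp add: sum_distrib_left algebra_simps)
  finally show ?thesis by simp
qed

section \<open>The truncated block matrix\<close>

definition block :: "nat \<Rightarrow> (nat \<Rightarrow> nat \<Rightarrow> real) \<Rightarrow> (nat \<Rightarrow> nat \<Rightarrow> real) \<Rightarrow> (nat \<Rightarrow> nat \<Rightarrow> real) \<Rightarrow>
    (nat \<Rightarrow> nat \<Rightarrow> real) \<Rightarrow> nat \<Rightarrow> nat \<Rightarrow> real" where
  "block N A B C D i j =
     (if i < N then (if j < N then A i j else B i (j - N))
      else (if j < N then C (i - N) j else D (i - N) (j - N)))"

lemma sum_lessThan_add:
  fixes f :: "nat \<Rightarrow> real"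
  shows "(\<Sum>l<N + m. f l) = (\<Sum>l<N. f l) + (\<Sum>l<m. f (N + l))"
  by (induction m) auto

text \<open>The order \<open>N + m\<close> passed to \<open>mat_app\<close> performs the truncation.
  Padding the tail of \<open>x\<close> with zeros lets the cut blocks act as full \<open>N\<close>
  by \<open>N\<close> matrices, so the Hadamard identities stay available.\<close>

lemma mat_app_block:
  assumes "m \<le> N"
  defines "z x \<equiv> \<lambda>j. if j < m then x (N + j) else 0"
  shows "i < N \<Longrightarrow> mat_app (N + m) (block N A B C D) x i = mat_app N A x i + mat_app N B (z x) i"
    and "mat_app (N + m) (block N A B C D) x (N + i) = mat_app N C x i + mat_app N D (z x) i"
proof -
  have "(\<Sum>l<m. P i l * x (N + l)) = mat_app N P (z x) i" for P i
    unfolding mat_app_def z_def using assms(1) by (intro sum.mono_neutral_cong_left) auto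
  then show "i < N \<Longrightarrow> mat_app (N + m) (block N A B C D) x i = mat_app N A x i + mat_app N B (z x) i"
    and "mat_app (N + m) (block N A B C D) x (N + i) = mat_app N C x i + mat_app N D (z x) i"
    unfolding mat_app_def sum_lessThan_add by (auto simp: block_def)
qed

lemma inner_le_L2: "(\<Sum>i\<in>S. f i * g i) \<le> L2_set f S * L2_set g S"
proof -
  have "(\<Sum>i\<in>S. f i * g i) \<le> (\<Sum>i\<in>S. \<bar>f i\<bar> * \<bar>g i\<bar>)"
    by (intro sum_mono) (metis abs_ge_self abs_mult)
  then show ?thesis using L2_set_mult_ineq[of f g S] by linarith
qed

lemma L2_set_minus [simp]: "L2_set (\<lambda>i. - f i) S = L2_set f S"
  by (simp add: L2_set_def)

lemma L2_set_power2: "(L2_set f S)\<^sup>2 = (\<Sum>i\<in>S. (f i)\<^sup>2)"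
  by (simp add: L2_set_def sum_nonneg)

text \<open>Eliminating the head of the input gives \<open>N w = C A u - (C A B + N K) z\<close>.
  Pairing with \<open>z\<close> bounds the tail \<open>z\<close> by the outputs, through the scalar
  symmetric parts of \<open>C A B\<close> and \<open>K\<close>; then \<open>A x = u - B z\<close>
  bounds the head. The upper bound is the triangle inequality in each block row.\<close>

lemma block_bounds:
  assumes T: "unbiased_triple N \<sigma> A B C" and K: "skew_hadamard N K"
    and \<sigma>: "0 \<le> \<sigma>" "real N \<le> 2 * \<sigma>\<^sup>2" and N: "0 < N" and m: "m \<le> N"
  defines "M \<equiv> block N A B C (\<lambda>i j. - K i j)"
  shows "real N * (\<Sum>i<N + m. (x i)\<^sup>2) \<le> 50 * (\<Sum>i<N + m. (mat_app (N + m) M x i)\<^sup>2)"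
    and "(\<Sum>i<N + m. (mat_app (N + m) M x i)\<^sup>2) \<le> 4 * real N * (\<Sum>i<N + m. (x i)\<^sup>2)"
proof -
  note T' = T[unfolded unbiased_triple_def] and K' = K[unfolded skew_hadamard_def]
  have hA: "hadamard N A" and hB: "hadamard N B" and hC: "hadamard N C" and hK: "hadamard N K"
    using T' K' by auto
  \<comment> \<open>\<open>z\<close> is the padded tail of the input and \<open>u\<close> the upper
    part of the output. \<open>w\<close> is the lower part before truncation: only its first
    \<open>m\<close> coordinates are outputs.\<close>
  define z where "z = (\<lambda>j. if j < m then x (N + j) else 0)"
  define u where "u = (\<lambda>i. mat_app N A x i + mat_app N B z i)"
  define w where "w = (\<lambda>i. mat_app N C x i - mat_app N K z i)"
  have neg: "mat_app N (\<lambda>i j. - K i j) z i = - mat_app N K z i" for i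
    by (simp add: mat_app_def sum_negf)
  define a b p q where "a = L2_set x {..<N}" and "b = L2_set z {..<N}"
    and "p = L2_set u {..<N}" and "q = L2_set w {..<m}"
  have nonneg: "0 \<le> a" "0 \<le> b" "0 \<le> p" "0 \<le> q"
    by (auto simp: a_def b_def p_def q_def L2_set_nonneg)
  have b_m: "b = L2_set z {..<m}"
    unfolding b_def L2_set_def using m
    by (intro arg_cong[of _ _ sqrt] sum.mono_neutral_right) (auto simp: z_def)
  have X: "(\<Sum>i<N + m. (x i)\<^sup>2) = a\<^sup>2 + b\<^sup>2"
    unfolding sum_lessThan_add b_m a_def L2_set_power2 by (simp add: z_def)
  have U: "(\<Sum>i<N + m. (mat_app (N + m) M x i)\<^sup>2) = p\<^sup>2 + q\<^sup>2"
    unfolding sum_lessThan_add p_def q_def L2_set_power2 M_def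
    using mat_app_block[OF m, where A = A and B = B and C = C and D = "\<lambda>i j. - K i j" and x = x]
    by (auto simp: u_def w_def neg simp flip: z_def)

  let ?E = "mat_mul N (mat_mul N C A) B"
  have AA: "mat_app N A (mat_app N A y) i = real N * y i" if "i < N" for y i
  proof -
    have "mat_app N A (mat_app N A y) i = mat_app N (\<lambda>i j. A j i) (mat_app N A y) i"
      unfolding mat_app_def using T' that by (intro sum.cong) auto
    then show ?thesis using transpose_hadamard_app[OF hA that] by simp
  qed
  \<comment> \<open>Applying \<open>C A\<close> to \<open>u\<close> removes \<open>x\<close> because
    \<open>A\<^sup>2 = N I\<close>. This is the Schur complement identity multiplied by
    \<open>N\<close>; \<open>?E\<close> is the unnormalised product \<open>C A B\<close>.\<close>
  have w_eq: "real N * w i = mat_app N C (mat_app N A u) i - mat_app N ?E z i - real N * mat_app N K z i" for i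
  proof -
    have "mat_app N C (mat_app N A u) i = mat_app N C (\<lambda>l. real N * x l + mat_app N A (mat_app N B z) l) i"
      by (rule fun_cong[OF mat_app_cong]) (simp add: u_def mat_app_add AA)
    also have "\<dots> = real N * mat_app N C x i + mat_app N ?E z i"
      unfolding mat_app_add mat_app_mat_mul[of N C A "mat_app N B z"] mat_app_mat_mul[of N "mat_mul N C A" B z]
      by (simp add: mat_app_def sum_distrib_left mult.left_commute)
    finally show ?thesis by (simp add: w_def algebra_simps)
  qed
  have "real N * (\<Sum>i<N. z i * w i) = (\<Sum>i<N. z i * mat_app N C (mat_app N A u) i) -
      (\<Sum>i<N. z i * mat_app N ?E z i) - real N * (\<Sum>i<N. z i * mat_app N K z i)"
  proof -
    have "real N * (\<Sum>i<N. z i * w i) = (\<Sum>i<N. z i * (real N * w i))"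
      by (simp add: sum_distrib_left algebra_simps)
    also have "\<dots> = (\<Sum>i<N. z i * mat_app N C (mat_app N A u) i) -
        (\<Sum>i<N. z i * mat_app N ?E z i) - real N * (\<Sum>i<N. z i * mat_app N K z i)"
      unfolding w_eq by (simp add: right_diff_distrib sum_subtractf sum_distrib_left mult.left_commute)
    finally show ?thesis .
  qed
  moreover have "(\<Sum>i<N. z i * mat_app N ?E z i) = real N * \<sigma> * b\<^sup>2"
    unfolding b_def L2_set_power2 using T' by (intro quadratic_form_sym) auto
  moreover have "(\<Sum>i<N. z i * mat_app N K z i) = 1 * b\<^sup>2"
    unfolding b_def L2_set_power2 using K' by (intro quadratic_form_sym) auto
  \<comment> \<open>Cauchy-Schwarz, where \<open>C\<close> and \<open>A\<close> each contribute a
    factor \<open>sqrt N\<close>.\<close>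
  moreover have "(\<Sum>i<N. z i * mat_app N C (mat_app N A u) i) \<le> real N * (b * p)"
    using inner_le_L2[of z "mat_app N C (mat_app N A u)" "{..<N}"]
    by (simp add: hadamard_L2[OF hC] hadamard_L2[OF hA] b_def p_def mult.left_commute flip: mult.assoc)
  \<comment> \<open>As \<open>z\<close> vanishes from index \<open>m\<close> on, the coordinates of
    \<open>w\<close> lost in the truncation do not enter the pairing. This is how the bound survives
    the cut.\<close>
  moreover have "- (\<Sum>i<N. z i * w i) \<le> b * q"
  proof -
    have "- (\<Sum>i<N. z i * w i) = (\<Sum>i<m. z i * - w i)"
      unfolding sum_negf[symmetric] using m
      by (intro sum.mono_neutral_cong_right) (auto simp: z_def)
    also have "\<dots> \<le> b * q"
      using inner_le_L2[of z "\<lambda>i. - w i" "{..<m}"] by (simp add: b_m q_def)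
    finally show ?thesis .
  qed
  ultimately have "real N * (\<sigma> * b\<^sup>2 + b\<^sup>2) \<le> real N * (b * p + b * q)"
    using mult_left_mono[of "- (\<Sum>i<N. z i * w i)" "b * q" "real N"] by (simp add: algebra_simps)
  then have "\<sigma> * b\<^sup>2 + b\<^sup>2 \<le> b * p + b * q" using N by simp
  \<comment> \<open>The term \<open>b\<^sup>2\<close> coming from \<open>K\<close> has the
    favourable sign and is discarded.\<close>
  then have "b * (\<sigma> * b) \<le> b * (p + q)"
    by (simp add: algebra_simps power2_eq_square) (use zero_le_square[of b] in linarith)
  then have \<sigma>b: "\<sigma> * b \<le> p + q"
    using nonneg by (cases "b = 0") auto
  have "sqrt N \<le> 2 * \<sigma>"
    by (rule real_le_lsqrt) (use \<sigma> in \<open>auto simp: power_mult_distrib intro: order_trans\<close>)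
  then have Nb: "sqrt N * b \<le> 2 * (p + q)"
    using mult_right_mono[of "sqrt N" "2 * \<sigma>" b] nonneg \<sigma>b by simp
  \<comment> \<open>With the tail under control, the head is recovered from
    \<open>A x = u - B z\<close>.\<close>
  have "sqrt N * a = L2_set (\<lambda>i. u i + - mat_app N B z i) {..<N}"
    by (simp add: u_def a_def hadamard_L2[OF hA])
  also have "\<dots> \<le> p + sqrt N * b"
    using L2_set_triangle_ineq[of u "\<lambda>i. - mat_app N B z i" "{..<N}"]
    by (simp add: p_def b_def hadamard_L2[OF hB])
  finally have Na: "sqrt N * a \<le> 3 * p + 2 * q" using Nb by simp

  have "sqrt N * (a + b) \<le> 5 * p + 4 * q" using Na Nb by (simp add: algebra_simps)
  then have "(sqrt N * (a + b))\<^sup>2 \<le> (5 * p + 4 * q)\<^sup>2"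
    using nonneg by (intro power_mono) auto
  \<comment> \<open>Adding \<open>(5 * p - 4 * q)\<^sup>2\<close> to the left-hand side gives
    \<open>50 * p\<^sup>2 + 32 * q\<^sup>2\<close>.\<close>
  also have "\<dots> \<le> 50 * (p\<^sup>2 + q\<^sup>2)"
    using zero_le_power2[of "5 * p - 4 * q"] by (simp add: power2_eq_square algebra_simps)
       (use zero_le_square[of q] in linarith)
  finally have "real N * (a + b)\<^sup>2 \<le> 50 * (p\<^sup>2 + q\<^sup>2)" by (simp add: power_mult_distrib)
  moreover have "real N * (a\<^sup>2 + b\<^sup>2) \<le> real N * (a + b)\<^sup>2"
    using nonneg by (intro mult_left_mono) (auto simp: power2_sum)
  ultimately show "real N * (\<Sum>i<N + m. (x i)\<^sup>2) \<le> 50 * (\<Sum>i<N + m. (mat_app (N + m) M x i)\<^sup>2)"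
    unfolding X U by linarith

  \<comment> \<open>Both \<open>p\<close> and \<open>q\<close> are at most
    \<open>sqrt N * (a + b)\<close>, and
    \<open>(a + b)\<^sup>2 \<le> 2 * (a\<^sup>2 + b\<^sup>2)\<close>; together these give the factor
    4.\<close>
  have "p \<le> sqrt N * (a + b)"
    using L2_set_triangle_ineq[of "mat_app N A x" "mat_app N B z" "{..<N}"]
    by (simp add: p_def u_def a_def b_def hadamard_L2[OF hA] hadamard_L2[OF hB] algebra_simps)
  then have "p\<^sup>2 \<le> (sqrt N * (a + b))\<^sup>2" using nonneg by (intro power_mono)
  moreover have "q\<^sup>2 \<le> (sqrt N * (a + b))\<^sup>2"
  proof -
    have "q\<^sup>2 \<le> (L2_set w {..<N})\<^sup>2"
      unfolding q_def L2_set_power2 using m by (intro sum_mono2) auto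
    also have "\<dots> \<le> (sqrt N * (a + b))\<^sup>2"
      using L2_set_triangle_ineq[of "mat_app N C x" "\<lambda>i. - mat_app N K z i" "{..<N}"]
      by (intro power_mono) (simp_all add: w_def a_def b_def hadamard_L2[OF hC] hadamard_L2[OF hK] algebra_simps)
    finally show ?thesis .
  qed
  ultimately have "p\<^sup>2 + q\<^sup>2 \<le> 2 * (real N * (a + b)\<^sup>2)" by (simp add: power_mult_distrib)
  also have "\<dots> \<le> 2 * (real N * (2 * (a\<^sup>2 + b\<^sup>2)))"
    using zero_le_power2[of "a - b"]
    by (intro mult_left_mono) (auto simp: power2_sum power2_diff)
  finally show "(\<Sum>i<N + m. (mat_app (N + m) M x i)\<^sup>2) \<le> 4 * real N * (\<Sum>i<N + m. (x i)\<^sup>2)"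
    unfolding X U by (simp add: algebra_simps)
qed

text \<open>Take for \<open>N\<close> the largest power of two up to \<open>n\<close>. Then
  \<open>n < 2 N\<close> turns the constant 50 into 100, and \<open>N \<le> n\<close> gives the
  upper bound.\<close>

lemma approximate_hadamard_exists:
  assumes "1 \<le> n"
  shows "\<exists>M. (\<forall>i<n. \<forall>j<n. M i j \<in> {-1, 1}) \<and>
    (\<forall>x. real n * (\<Sum>i<n. (x i)\<^sup>2) \<le> 100 * (\<Sum>i<n. (mat_app n M x i)\<^sup>2) \<and>
      (\<Sum>i<n. (mat_app n M x i)\<^sup>2) \<le> 4 * real n * (\<Sum>i<n. (x i)\<^sup>2))"
proof -
  obtain k where k: "2 ^ k \<le> n" "n < 2 ^ (k + 1)"
    using ex_power_ivl1[of 2 n] assms by auto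
  define m where "m = n - 2 ^ k"
  let ?N = "2 ^ k :: nat"
  have n: "n = ?N + m" and m: "m \<le> ?N" using k by (auto simp: m_def)
  obtain \<sigma> A B C where T: "0 \<le> \<sigma>" "2 ^ k \<le> 2 * \<sigma>\<^sup>2" "unbiased_triple ?N \<sigma> A B C"
    using unbiased_triple_exists by blast
  obtain K where K: "skew_hadamard ?N K" using skew_hadamard_exists by blast
  define M where "M = block ?N A B C (\<lambda>i j. - K i j)"
  have T2: "real ?N \<le> 2 * \<sigma>\<^sup>2" using T by simp
  note bd = block_bounds[OF T(3) K T(1) T2 _ m, folded M_def n, simplified]
  have "M i j \<in> {-1, 1}" if "i < n" "j < n" for i j
  proof -
    have h: "hadamard ?N A" "hadamard ?N B" "hadamard ?N C" "hadamard ?N K"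
      using T(3) K by (auto simp: unbiased_triple_def skew_hadamard_def)
    show ?thesis
      unfolding M_def block_def using that n m hadamard_sign[OF h(1), of i j]
        hadamard_sign[OF h(2), of i "j - ?N"] hadamard_sign[OF h(3), of "i - ?N" j]
        hadamard_sign[OF h(4), of "i - ?N" "j - ?N"] by auto
  qed
  moreover have "real n * (\<Sum>i<n. (x i)\<^sup>2) \<le> 100 * (\<Sum>i<n. (mat_app n M x i)\<^sup>2)" for x
  proof -
    have "real n \<le> 2 * 2 ^ k" using of_nat_mono[of n "2 * 2 ^ k", where ?'a = real] k(2) by simp
    then have "real n * (\<Sum>i<n. (x i)\<^sup>2) \<le> 2 * 2 ^ k * (\<Sum>i<n. (x i)\<^sup>2)"
      by (intro mult_right_mono sum_nonneg) auto
    then show ?thesis using bd(1)[of x] by linarith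
  qed
  moreover have "(\<Sum>i<n. (mat_app n M x i)\<^sup>2) \<le> 4 * real n * (\<Sum>i<n. (x i)\<^sup>2)" for x
  proof -
    have "4 * 2 ^ k \<le> 4 * real n" using of_nat_mono[OF k(1), where ?'a = real] by simp
    then have "4 * 2 ^ k * (\<Sum>i<n. (x i)\<^sup>2) \<le> 4 * real n * (\<Sum>i<n. (x i)\<^sup>2)"
      by (intro mult_right_mono sum_nonneg) auto
    then show ?thesis using bd(2)[of x] by linarith
  qed
  ultimately show ?thesis by blast
qed

section \<open>Eigenvalues of real symmetric matrices and of Gram matrices\<close>

text \<open>This makes \<open>Max\<close> and \<open>Min\<close> of the spectrum meaningful. A
  complex eigenvalue exists; symmetry forces it to be real, and then the real or the imaginary part
  of its eigenvector is a real eigenvector.\<close>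

lemma real_symmetric_spectrum_nonempty:
  fixes S :: "real mat"
  assumes S: "S \<in> carrier_mat n n" and sym: "transpose_mat S = S" and n: "0 < n"
  shows "spectrum S \<noteq> {}"
proof -
  let ?C = "map_mat complex_of_real S"
  have C: "?C \<in> carrier_mat n n" using S by simp
  from spectrum_non_empty[OF C n] obtain k v where v: "eigenvector ?C v k"
    by (auto simp: spectrum_def eigenvalue_def)
  then have vc: "v \<in> carrier_vec n" and v0: "v \<noteq> 0\<^sub>v n" and ev: "?C *\<^sub>v v = k \<cdot>\<^sub>v v"
    using S by (auto simp: eigenvector_def)
  define x y where "x = map_vec Re v" and "y = map_vec Im v"
  have xc: "x \<in> carrier_vec n" and yc: "y \<in> carrier_vec n"
    using vc by (auto simp: x_def y_def)
  have comp: "(\<Sum>j<n. complex_of_real (S $$ (i, j)) * v $ j) = k * v $ i" if "i < n" for i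
    using arg_cong[OF ev, of "\<lambda>w. w $ i"] that S vc
    by (auto simp: scalar_prod_def atLeast0LessThan)
  have Sx: "S *\<^sub>v x = Re k \<cdot>\<^sub>v x - Im k \<cdot>\<^sub>v y"
  proof (rule eq_vecI)
    fix i assume "i < dim_vec (Re k \<cdot>\<^sub>v x - Im k \<cdot>\<^sub>v y)"
    then have i: "i < n" using yc by simp
    show "(S *\<^sub>v x) $ i = (Re k \<cdot>\<^sub>v x - Im k \<cdot>\<^sub>v y) $ i"
      using arg_cong[OF comp[OF i], of Re] i S vc
      by (auto simp: scalar_prod_def atLeast0LessThan x_def y_def)
  qed (use S yc in auto)
  have Sy: "S *\<^sub>v y = Re k \<cdot>\<^sub>v y + Im k \<cdot>\<^sub>v x"
  proof (rule eq_vecI)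
    fix i assume "i < dim_vec (Re k \<cdot>\<^sub>v y + Im k \<cdot>\<^sub>v x)"
    then have i: "i < n" using xc by simp
    show "(S *\<^sub>v y) $ i = (Re k \<cdot>\<^sub>v y + Im k \<cdot>\<^sub>v x) $ i"
      using arg_cong[OF comp[OF i], of Im] i S vc
      by (auto simp: scalar_prod_def atLeast0LessThan x_def y_def)
  qed (use S xc in auto)
  have "(S *\<^sub>v x) \<bullet> y = x \<bullet> (S *\<^sub>v y)"
    using transpose_vec_mult_scalar[OF S yc xc] sym by simp
  then have "(Re k \<cdot>\<^sub>v x - Im k \<cdot>\<^sub>v y) \<bullet> y = x \<bullet> (Re k \<cdot>\<^sub>v y + Im k \<cdot>\<^sub>v x)"
    by (simp add: Sx Sy)
  \<comment> \<open>Both sides contain \<open>Re k * (x \<bullet> y)\<close>, which cancels.\<close>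
  then have "Im k * (x \<bullet> x + y \<bullet> y) = 0"
    using xc yc
    by (simp add: minus_scalar_prod_distrib[of _ n] scalar_prod_add_distrib[of _ n] algebra_simps)
  moreover have "x \<bullet> x + y \<bullet> y \<noteq> 0"
  proof
    assume "x \<bullet> x + y \<bullet> y = 0"
    moreover have "x \<bullet> x = (\<Sum>i<n. (Re (v $ i))\<^sup>2)" "y \<bullet> y = (\<Sum>i<n. (Im (v $ i))\<^sup>2)"
      using vc by (auto simp: scalar_prod_def x_def y_def power2_eq_square atLeast0LessThan)
    ultimately have "(\<Sum>i<n. (cmod (v $ i))\<^sup>2) = 0"
      by (simp add: cmod_power2 sum.distrib)
    then have "v = 0\<^sub>v n" using vc by (intro eq_vecI) (auto simp: sum_nonneg_eq_0_iff)
    then show False using v0 by simp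
  qed
  ultimately have "Im k = 0" by simp
  then have "S *\<^sub>v x = Re k \<cdot>\<^sub>v x" "S *\<^sub>v y = Re k \<cdot>\<^sub>v y"
    unfolding Sx Sy using xc yc by auto
  moreover have "x \<noteq> 0\<^sub>v n \<or> y \<noteq> 0\<^sub>v n"
    using \<open>x \<bullet> x + y \<bullet> y \<noteq> 0\<close> by auto
  ultimately have "eigenvector S x (Re k) \<or> eigenvector S y (Re k)"
    using S xc yc by (auto simp: eigenvector_def)
  then show ?thesis by (auto simp: spectrum_def eigenvalue_def)
qed

text \<open>For an eigenvector \<open>w\<close>, the squared norm of \<open>V\<^sup>T w\<close> is
  \<open>w \<bullet> (V V\<^sup>T w) = \<mu> * (w \<bullet> w)\<close>, and
  \<open>w \<bullet> w\<close> is positive.\<close>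

lemma gram_eigenvalue_bounds:
  fixes V :: "real mat"
  assumes V: "V \<in> carrier_mat n n" and ev: "\<mu> \<in> spectrum (V * transpose_mat V)"
    and low: "\<And>w. w \<in> carrier_vec n \<Longrightarrow> l * (w \<bullet> w) \<le> (transpose_mat V *\<^sub>v w) \<bullet> (transpose_mat V *\<^sub>v w)"
    and up: "\<And>w. w \<in> carrier_vec n \<Longrightarrow> (transpose_mat V *\<^sub>v w) \<bullet> (transpose_mat V *\<^sub>v w) \<le> h * (w \<bullet> w)"
  shows "l \<le> \<mu>" "\<mu> \<le> h"
proof -
  obtain w where w: "w \<in> carrier_vec n" "w \<noteq> 0\<^sub>v n" "V * transpose_mat V *\<^sub>v w = \<mu> \<cdot>\<^sub>v w"
    using ev V by (auto simp: spectrum_def eigenvalue_def eigenvector_def)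
  have tw: "transpose_mat V *\<^sub>v w \<in> carrier_vec n" using V w by auto
  have "(transpose_mat V *\<^sub>v w) \<bullet> (transpose_mat V *\<^sub>v w) = w \<bullet> (V *\<^sub>v (transpose_mat V *\<^sub>v w))"
    by (rule transpose_vec_mult_scalar[OF V tw w(1)])
  also have "V *\<^sub>v (transpose_mat V *\<^sub>v w) = \<mu> \<cdot>\<^sub>v w"
    using V w by (subst assoc_mult_mat_vec[symmetric]) auto
  finally have eq: "(transpose_mat V *\<^sub>v w) \<bullet> (transpose_mat V *\<^sub>v w) = \<mu> * (w \<bullet> w)"
    using w by simp
  have ww: "w \<bullet> w = (\<Sum>i<n. (w $ i)\<^sup>2)"
    using w(1) by (auto simp: scalar_prod_def power2_eq_square atLeast0LessThan)
  have "w \<bullet> w \<noteq> 0"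
  proof
    assume "w \<bullet> w = 0"
    then have "w = 0\<^sub>v n" unfolding ww using w(1) by (intro eq_vecI) (auto simp: sum_nonneg_eq_0_iff)
    then show False using w(2) by simp
  qed
  then have pos: "0 < w \<bullet> w" unfolding ww by (simp add: order_less_le sum_nonneg)
  show "l \<le> \<mu>" using low[OF w(1)] pos unfolding eq by simp
  show "\<mu> \<le> h" using up[OF w(1)] pos unfolding eq by simp
qed

theorem theorem1p2:
  shows "\<exists>c C :: real. 0 < c \<and> c < C \<and>
    (\<forall>n :: nat. n \<ge> 1 \<longrightarrow>
      (\<exists>V :: real mat. V \<in> carrier_mat n n \<and>
        (\<forall>i < n. \<forall>j < n. V $$ (i, j) \<in> {-1, 1}) \<and>
        c * sqrt (real n) \<le> s_min V \<and> s_min V \<le> s_max V \<and> s_max V \<le> C * sqrt (real n)))"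
proof (rule exI[of _ "1/10"], rule exI[of _ 2], intro conjI allI impI)
  fix n :: nat assume n: "1 \<le> n"
  obtain M where sgn: "\<And>i j. i < n \<Longrightarrow> j < n \<Longrightarrow> M i j \<in> {-1, 1}"
    and low: "\<And>x. real n * (\<Sum>i<n. (x i)\<^sup>2) \<le> 100 * (\<Sum>i<n. (mat_app n M x i)\<^sup>2)"
    and up: "\<And>x. (\<Sum>i<n. (mat_app n M x i)\<^sup>2) \<le> 4 * real n * (\<Sum>i<n. (x i)\<^sup>2)"
    using approximate_hadamard_exists[OF n] by blast
  \<comment> \<open>The transpose of \<open>M\<close> is taken because singular values are read off
    \<open>V V\<^sup>T\<close>, whose quadratic form involves \<open>V\<^sup>T = M\<close>.\<close>
  define V where "V = mat n n (\<lambda>(i, j). M j i)"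
  let ?S = "V * transpose_mat V"
  have V: "V \<in> carrier_mat n n" by (simp add: V_def)
  have S: "?S \<in> carrier_mat n n" using V by auto
  have sq: "w \<bullet> w = (\<Sum>i<n. (w $ i)\<^sup>2)" if "w \<in> carrier_vec n" for w :: "real vec"
    using that by (auto simp: scalar_prod_def power2_eq_square atLeast0LessThan)
  have img: "(transpose_mat V *\<^sub>v w) \<bullet> (transpose_mat V *\<^sub>v w) = (\<Sum>i<n. (mat_app n M (vec_index w) i)\<^sup>2)"
    if w: "w \<in> carrier_vec n" for w
  proof -
    have "(transpose_mat V *\<^sub>v w) $ i = mat_app n M (vec_index w) i" if "i < n" for i
      using w that by (auto simp: V_def mat_app_def scalar_prod_def atLeast0LessThan)
    moreover have "transpose_mat V *\<^sub>v w \<in> carrier_vec n" using V w by auto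
    ultimately show ?thesis by (simp add: sq)
  qed
  have bounds: "real n / 100 \<le> \<mu>" "\<mu> \<le> 4 * real n" if "\<mu> \<in> spectrum ?S" for \<mu>
  proof -
    have "real n / 100 * (w \<bullet> w) \<le> (transpose_mat V *\<^sub>v w) \<bullet> (transpose_mat V *\<^sub>v w)"
      and "(transpose_mat V *\<^sub>v w) \<bullet> (transpose_mat V *\<^sub>v w) \<le> 4 * real n * (w \<bullet> w)"
      if "w \<in> carrier_vec n" for w
      using low[of "vec_index w"] up[of "vec_index w"] that by (simp_all add: img sq)
    then show "real n / 100 \<le> \<mu>" "\<mu> \<le> 4 * real n"
      using gram_eigenvalue_bounds[OF V that] by blast+
  qed
  have fin: "finite (spectrum ?S)" by (rule card_finite_spectrum[OF S])
  have ne: "spectrum ?S \<noteq> {}"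
    using n V by (intro real_symmetric_spectrum_nonempty[OF S]) (auto simp: transpose_mult[OF V])
  have Min: "Min (spectrum ?S) \<in> spectrum ?S" and Max: "Max (spectrum ?S) \<in> spectrum ?S"
    using fin ne by auto
  \<comment> \<open>The witnesses 1/10 and 2 are the square roots of the constants 1/100 and 4 in
    \<open>bounds\<close>.\<close>
  have sqrt_n: "sqrt (real n / 100) = 1/10 * sqrt (real n)" "sqrt (4 * real n) = 2 * sqrt (real n)"
    using real_sqrt_abs[of 10] real_sqrt_abs[of 2] by (simp_all add: real_sqrt_divide real_sqrt_mult)
  show "\<exists>V :: real mat. V \<in> carrier_mat n n \<and>
        (\<forall>i < n. \<forall>j < n. V $$ (i, j) \<in> {-1, 1}) \<and>
        1/10 * sqrt (real n) \<le> s_min V \<and> s_min V \<le> s_max V \<and> s_max V \<le> 2 * sqrt (real n)"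
  proof (intro exI[of _ V] conjI allI impI)
    show "V $$ (i, j) \<in> {-1, 1}" if "i < n" "j < n" for i j
      using sgn[OF that(2,1)] that by (simp add: V_def)
    show "1/10 * sqrt (real n) \<le> s_min V"
      unfolding s_min_def sqrt_n(1)[symmetric] using bounds(1)[OF Min] by (rule real_sqrt_le_mono)
    show "s_min V \<le> s_max V"
      unfolding s_min_def s_max_def using Min_le[OF fin Max] by (rule real_sqrt_le_mono)
    show "s_max V \<le> 2 * sqrt (real n)"
      unfolding s_max_def sqrt_n(2)[symmetric] using bounds(2)[OF Max] by (rule real_sqrt_le_mono)
  qed (rule V)
qed simp_all

end
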